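(* Let $(x^*,y^* )\in W$ be a strong local solution of the standard optimistic bilevel problem (SBP). Then $x^*$ is a local solution of the original optimistic bilevel problem (OBP).
   Context: Data and standing assumptions: $F,f:\mathbb{R}^{n_1}\times\mathbb{R}^{n_2}\to\mathbb{R}$ and $g:\mathbb{R}^{n_1}\times\mathbb{R}^{n_2}\to\mathbb{R}^m$ are continuous; $X\subseteq\mathbb{R}^{n_1}$ and $U\subseteq\mathbb{R}^{n_2}$ are closed. Vector inequalities are componentwise. Let $K(x):=\{v\in\mathbb{R}^{n_2}: g(x,v)\le 0\}$ and let $S(x)$ be the set of global minimizers of $w\mapsto f(x,w)$ over $w\in U\cap K(x)$ (empty if there are none). SBP: minimize $F(x,y)$ over $(x,y)\in W$, where $W:=\{(x,y): x\in X,\ y\in S(x)\}$. A point $(x^*,y^* )$ is a strong local solution of the SBP if $(x^*,y^* )\in W$ and there is an open neighborhood $N^*$ of $x^*$ in $\mathbb{R}^{n_1}$ such that $F(x^*,y^* )\le F(x,y)$ for all $(x,y)\in W\cap(N^*\times\mathbb{R}^{n_2})$. OBP: minimize over $x\in X$ the function $\Phi(x):=\min_y\{F(x,y): y\in S(x)\}$, where the minimum is read as an infimum in $[-\infty,+\infty]$, with value $+\infty$ if $S(x)=\emptyset$. A point $x^*\in X$ is a local solution of the OBP if $\min_y\{F(x^*,y): y\in S(x^* )\}$ is attained (hence finite) and there is an open neighborhood $N^*$ of $x^*$ such that $\Phi(x^* )\le\Phi(x)$ for all $x\in X\cap N^*$. *)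

theory Defs
  imports "HOL-Analysis.Analysis"
begin

(* The order on real ^ 'm is the library's componentwise order (less_eq_vec_def). *)
definition lower_feasible ::
  "((real ^ 'n1) \<times> (real ^ 'n2) \<Rightarrow> real ^ 'm) \<Rightarrow> real ^ 'n1 \<Rightarrow> (real ^ 'n2) set" where
  "lower_feasible g x = {v. g (x, v) \<le> 0}"

definition lower_solutions ::
  "((real ^ 'n1) \<times> (real ^ 'n2) \<Rightarrow> real) \<Rightarrow> ((real ^ 'n1) \<times> (real ^ 'n2) \<Rightarrow> real ^ 'm)
    \<Rightarrow> (real ^ 'n2) set \<Rightarrow> real ^ 'n1 \<Rightarrow> (real ^ 'n2) set" where
  "lower_solutions f g U x =
    {w \<in> U \<inter> lower_feasible g x. \<forall>v \<in> U \<inter> lower_feasible g x. f (x, w) \<le> f (x, v)}"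

definition SBP_feasible ::
  "((real ^ 'n1) \<times> (real ^ 'n2) \<Rightarrow> real) \<Rightarrow> ((real ^ 'n1) \<times> (real ^ 'n2) \<Rightarrow> real ^ 'm)
    \<Rightarrow> (real ^ 'n1) set \<Rightarrow> (real ^ 'n2) set \<Rightarrow> ((real ^ 'n1) \<times> (real ^ 'n2)) set" where
  "SBP_feasible f g X U = {(x, y). x \<in> X \<and> y \<in> lower_solutions f g U x}"

(* The neighbourhood restricts only the upper-level variable; y ranges over all of R^n2. *)
definition SBP_strong_local_solution ::
  "((real ^ 'n1) \<times> (real ^ 'n2) \<Rightarrow> real) \<Rightarrow> ((real ^ 'n1) \<times> (real ^ 'n2) \<Rightarrow> real)
    \<Rightarrow> ((real ^ 'n1) \<times> (real ^ 'n2) \<Rightarrow> real ^ 'm) \<Rightarrow> (real ^ 'n1) set \<Rightarrow> (real ^ 'n2) set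
    \<Rightarrow> (real ^ 'n1) \<times> (real ^ 'n2) \<Rightarrow> bool" where
  "SBP_strong_local_solution F f g X U p \<longleftrightarrow>
    p \<in> SBP_feasible f g X U \<and>
    (\<exists>N. open N \<and> fst p \<in> N \<and>
      (\<forall>q \<in> SBP_feasible f g X U \<inter> (N \<times> UNIV). F p \<le> F q))"

(* Infimum in [-\<infinity>, +\<infinity>]; on ereal the infimum of the empty set is +\<infinity>. *)
definition OBP_value ::
  "((real ^ 'n1) \<times> (real ^ 'n2) \<Rightarrow> real) \<Rightarrow> ((real ^ 'n1) \<times> (real ^ 'n2) \<Rightarrow> real)
    \<Rightarrow> ((real ^ 'n1) \<times> (real ^ 'n2) \<Rightarrow> real ^ 'm) \<Rightarrow> (real ^ 'n2) set \<Rightarrow> real ^ 'n1 \<Rightarrow> ereal" where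
  "OBP_value F f g U x = (INF y \<in> lower_solutions f g U x. ereal (F (x, y)))"

(* The second conjunct says that the infimum defining the value at x is attained. *)
definition OBP_local_solution ::
  "((real ^ 'n1) \<times> (real ^ 'n2) \<Rightarrow> real) \<Rightarrow> ((real ^ 'n1) \<times> (real ^ 'n2) \<Rightarrow> real)
    \<Rightarrow> ((real ^ 'n1) \<times> (real ^ 'n2) \<Rightarrow> real ^ 'm) \<Rightarrow> (real ^ 'n1) set \<Rightarrow> (real ^ 'n2) set
    \<Rightarrow> real ^ 'n1 \<Rightarrow> bool" where
  "OBP_local_solution F f g X U x \<longleftrightarrow>
    x \<in> X \<and>
    (\<exists>y \<in> lower_solutions f g U x. OBP_value F f g U x = ereal (F (x, y))) \<and>
    (\<exists>N. open N \<and> x \<in> N \<and> (\<forall>x' \<in> X \<inter> N. OBP_value F f g U x \<le> OBP_value F f g U x'))"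

end

theory Submission
  imports Defs
begin

text \<open>The neighbourhood \<open>N\<close> of a strong local solution restricts only the
  upper-level variable. Hence, for each \<open>x\<close> in \<open>X \<inter> N\<close>, the number
  \<open>F (xs, ys)\<close> bounds \<open>F (x, y)\<close> from below over all lower-level solutions
  \<open>y\<close>, and so bounds their infimum. At \<open>xs\<close> the point \<open>ys\<close>
  attains this bound, which gives both attainment and local minimality.\<close>

theorem proposition3p13:
  fixes F f :: "(real ^ 'n1) \<times> (real ^ 'n2) \<Rightarrow> real"
    and g :: "(real ^ 'n1) \<times> (real ^ 'n2) \<Rightarrow> real ^ 'm"
    and X :: "(real ^ 'n1) set" and U :: "(real ^ 'n2) set"
    and xs :: "real ^ 'n1" and ys :: "real ^ 'n2"
  assumes "continuous_on UNIV F" and "continuous_on UNIV f" and "continuous_on UNIV g"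
    and "closed X" and "closed U"
    and "(xs, ys) \<in> SBP_feasible f g X U"
    and "SBP_strong_local_solution F f g X U (xs, ys)"
  shows "OBP_local_solution F f g X U xs"
proof -
  have xs: "xs \<in> X" and ys: "ys \<in> lower_solutions f g U xs"
    using assms(6) by (auto simp: SBP_feasible_def)
  obtain N where N: "open N" "xs \<in> N"
    and min: "\<And>q. q \<in> SBP_feasible f g X U \<inter> (N \<times> UNIV) \<Longrightarrow> F (xs, ys) \<le> F q"
    using assms(7) by (auto simp: SBP_strong_local_solution_def)
  \<comment> \<open>If \<open>x\<close> has no lower-level solution, the infimum is \<infinity> and
    the bound holds vacuously.\<close>
  have lower: "ereal (F (xs, ys)) \<le> OBP_value F f g U x" if "x \<in> X \<inter> N" for x
    unfolding OBP_value_def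
  proof (rule INF_greatest)
    fix y assume "y \<in> lower_solutions f g U x"
    with that have "F (xs, ys) \<le> F (x, y)"
      by (intro min) (auto simp: SBP_feasible_def)
    then show "ereal (F (xs, ys)) \<le> ereal (F (x, y))" by simp
  qed
  have "OBP_value F f g U xs \<le> ereal (F (xs, ys))"
    unfolding OBP_value_def using ys by (rule INF_lower)
  \<comment> \<open>Since \<open>xs\<close> lies in \<open>N\<close>, the bound \<open>lower\<close>
    also applies at \<open>xs\<close> itself: \<open>ys\<close> is an optimistic choice
    there.\<close>
  then have value_xs: "OBP_value F f g U xs = ereal (F (xs, ys))"
    using lower[of xs] xs N(2) by (intro antisym) auto
  show ?thesis
    unfolding OBP_local_solution_def
  proof (intro conjI)
    show "\<exists>y \<in> lower_solutions f g U xs. OBP_value F f g U xs = ereal (F (xs, y))"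
      using ys value_xs by blast
    show "\<exists>N. open N \<and> xs \<in> N \<and> (\<forall>x' \<in> X \<inter> N. OBP_value F f g U xs \<le> OBP_value F f g U x')"
      using N lower value_xs by auto
  qed (rule xs)
qed

end
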